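(* Let $\varepsilon>0$, let $\delta_1,\delta_2,\delta_3\in[0,1]$, and let $D_\pm$ be periodic first-derivative upwind summation-by-parts (SBP) operators with diagonal mass matrix $M$ and induced central operator $D_1=(D_++D_-)/2$. Then the semidiscretization $$\partial_t\begin{pmatrix}\mathbf u\\ \mathbf v\\ \mathbf w\end{pmatrix}=\begin{pmatrix}-\frac13\bigl(\mathbf uD_1\mathbf u+D_1\mathbf u^2\bigr)-\delta_1\varepsilon D_+\mathbf v\\ -\frac{\delta_2}{\varepsilon}D_-\mathbf u\\ -\delta_3\varepsilon^2D_1\mathbf w\end{pmatrix}+\begin{pmatrix}-(1-\delta_1\varepsilon)D_+\mathbf v\\ -\frac{1-\delta_2\varepsilon}{\varepsilon^2}D_-\mathbf u+\frac1{\varepsilon^2}\mathbf w\\ -(1-\delta_3)\varepsilon^2D_1\mathbf w-\mathbf v\end{pmatrix}$$ of the BBMH system $u_t+uu_x+v_x=0$, $v_t+\varepsilon^{-2}u_x=\varepsilon^{-2}w$, $w_t+\varepsilon^2w_x=-v$ conserves the invariants $$\mathbf 1^TM\mathbf u\qquad\text{and}\qquad\frac12\bigl(\mathbf u^TM\mathbf u+\varepsilon^2\mathbf v^TM\mathbf v+\mathbf w^TM\mathbf w\bigr),$$ which are discrete approximations of $\int u\,dx$ and $\frac12\int(u^2+\varepsilon^2v^2+w^2)\,dx$, respectively; that is, both quantities are constant in time along every solution of the semidiscretization.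
   Context: $\mathbf u,\mathbf v,\mathbf w\in\mathbb R^N$ are time-dependent vectors of nodal values on a grid of $N$ points; products and powers of vectors (as in $\mathbf uD_1\mathbf u$ and $\mathbf u^2$) are componentwise, and $\mathbf 1=(1,\dots,1)^T$. A periodic first-derivative upwind SBP operator consists of a grid, consistent first-derivative operators $D_\pm\in\mathbb R^{N\times N}$ (in particular $D_\pm\mathbf 1=\mathbf 0$), and a symmetric positive-definite mass matrix $M\in\mathbb R^{N\times N}$ such that $MD_++D_-^TM=0$ and $\frac12M(D_+-D_-)$ is negative semidefinite. *)

theory Defs
  imports "HOL-Analysis.Analysis"
begin

definition diagonal_matrix :: "real^'n^'n \<Rightarrow> bool" where
  "diagonal_matrix A \<longleftrightarrow> (\<forall>i j. i \<noteq> j \<longrightarrow> A $ i $ j = 0)"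

definition symmetric_pos_def :: "real^'n^'n \<Rightarrow> bool" where
  "symmetric_pos_def A \<longleftrightarrow> transpose A = A \<and> (\<forall>x. x \<noteq> 0 \<longrightarrow> x \<bullet> (A *v x) > 0)"

definition negative_semidefinite :: "real^'n^'n \<Rightarrow> bool" where
  "negative_semidefinite A \<longleftrightarrow> (\<forall>x. x \<bullet> (A *v x) \<le> 0)"

record 'n sbp_data =
  grid :: "real^'n"
  Dplus :: "real^'n^'n"
  Dminus :: "real^'n^'n"
  mass_matrix :: "real^'n^'n"

text \<open>
  On one fixed periodic grid, consistency of a first-derivative matrix means that it
  differentiates constants exactly (higher monomials are not periodic); \<open>1\<close> is the
  vector with all components 1.  The nodes are not constrained: nodes may be nonuniform,
  and may coincide, as at element interfaces of discontinuous Galerkin grids.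
  Symmetry of \<open>M (D\<^sub>+ - D\<^sub>-)\<close> is not required separately, since it follows
  from \<open>M D\<^sub>+ + D\<^sub>-\<^sup>T M = 0\<close> and the symmetry of \<open>M\<close>.
\<close>

definition consistent_periodic_deriv :: "real^'n^'n \<Rightarrow> bool" where
  "consistent_periodic_deriv D \<longleftrightarrow> D *v 1 = 0"

definition periodic_upwind_sbp :: "'n::finite sbp_data \<Rightarrow> bool" where
  "periodic_upwind_sbp S \<longleftrightarrow>
     consistent_periodic_deriv (Dplus S) \<and>
     consistent_periodic_deriv (Dminus S) \<and>
     symmetric_pos_def (mass_matrix S) \<and>
     mass_matrix S ** Dplus S + transpose (Dminus S) ** mass_matrix S = 0 \<and>
     negative_semidefinite ((1 / 2) *\<^sub>R (mass_matrix S ** (Dplus S - Dminus S)))"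

definition Dcentral :: "'n::finite sbp_data \<Rightarrow> real^'n^'n" where
  "Dcentral S = (1 / 2) *\<^sub>R (Dplus S + Dminus S)"

text \<open>
  The two summands of the split right-hand side, as functions of the state
  \<open>(u, v, w)\<close>.  Multiplication and powers on \<^typ>\<open>real^'n\<close> are componentwise.
\<close>

definition bbmh_rhs1 ::
  "'n::finite sbp_data \<Rightarrow> real \<Rightarrow> real \<Rightarrow> real \<Rightarrow> real \<Rightarrow>
    (real^'n) \<times> (real^'n) \<times> (real^'n) \<Rightarrow> (real^'n) \<times> (real^'n) \<times> (real^'n)" where
  "bbmh_rhs1 S \<epsilon> \<delta>1 \<delta>2 \<delta>3 = (\<lambda>(u, v, w).
     (- (1 / 3) *\<^sub>R (u * (Dcentral S *v u) + Dcentral S *v (u ^ 2))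
        - (\<delta>1 * \<epsilon>) *\<^sub>R (Dplus S *v v),
      - (\<delta>2 / \<epsilon>) *\<^sub>R (Dminus S *v u),
      - (\<delta>3 * \<epsilon>\<^sup>2) *\<^sub>R (Dcentral S *v w)))"

definition bbmh_rhs2 ::
  "'n::finite sbp_data \<Rightarrow> real \<Rightarrow> real \<Rightarrow> real \<Rightarrow> real \<Rightarrow>
    (real^'n) \<times> (real^'n) \<times> (real^'n) \<Rightarrow> (real^'n) \<times> (real^'n) \<times> (real^'n)" where
  "bbmh_rhs2 S \<epsilon> \<delta>1 \<delta>2 \<delta>3 = (\<lambda>(u, v, w).
     (- (1 - \<delta>1 * \<epsilon>) *\<^sub>R (Dplus S *v v),
      - ((1 - \<delta>2 * \<epsilon>) / \<epsilon>\<^sup>2) *\<^sub>R (Dminus S *v u) + (1 / \<epsilon>\<^sup>2) *\<^sub>R w,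
      - ((1 - \<delta>3) * \<epsilon>\<^sup>2) *\<^sub>R (Dcentral S *v w) - v))"

definition bbmh_solution ::
  "'n::finite sbp_data \<Rightarrow> real \<Rightarrow> real \<Rightarrow> real \<Rightarrow> real \<Rightarrow> real set \<Rightarrow>
    (real \<Rightarrow> real^'n) \<Rightarrow> (real \<Rightarrow> real^'n) \<Rightarrow> (real \<Rightarrow> real^'n) \<Rightarrow> bool" where
  "bbmh_solution S \<epsilon> \<delta>1 \<delta>2 \<delta>3 T u v w \<longleftrightarrow>
     (\<forall>t\<in>T. ((\<lambda>s. (u s, v s, w s)) has_vector_derivative
        (bbmh_rhs1 S \<epsilon> \<delta>1 \<delta>2 \<delta>3 (u t, v t, w t) + bbmh_rhs2 S \<epsilon> \<delta>1 \<delta>2 \<delta>3 (u t, v t, w t)))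
        (at t within T))"

definition discrete_mass :: "'n::finite sbp_data \<Rightarrow> real^'n \<Rightarrow> real" where
  "discrete_mass S u = 1 \<bullet> (mass_matrix S *v u)"

definition discrete_energy ::
  "'n::finite sbp_data \<Rightarrow> real \<Rightarrow> real^'n \<Rightarrow> real^'n \<Rightarrow> real^'n \<Rightarrow> real" where
  "discrete_energy S \<epsilon> u v w =
     1 / 2 * (u \<bullet> (mass_matrix S *v u) + \<epsilon>\<^sup>2 * (v \<bullet> (mass_matrix S *v v))
              + w \<bullet> (mass_matrix S *v w))"

end

theory Submission
  imports Defs
begin

text \<open>
  With respect to the inner product \<open>\<langle>x, y\<rangle> = x\<^sup>T M y\<close> the summation-by-parts property says that
  \<open>- D\<^sub>-\<close> is the adjoint of \<open>D\<^sub>+\<close>, so \<open>D\<^sub>1\<close> is skew-adjoint, and since \<open>M\<close> is diagonal,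
  componentwise multiplication is self-adjoint.  Hence
  \<open>\<langle>u, u D\<^sub>1 u\<rangle> = \<langle>u\<^sup>2, D\<^sub>1 u\<rangle> = - \<langle>D\<^sub>1 u\<^sup>2, u\<rangle>\<close> cancels against the second half of the split nonlinear
  term, the coupling of \<open>u\<close> and \<open>v\<close> cancels by adjointness, and the coupling of \<open>v\<close> and \<open>w\<close> by
  symmetry; pairing with \<open>1\<close> and using \<open>D\<^sub>\<plusminus> 1 = 0\<close> gives conservation of mass.
\<close>

lemma diagonal_matrix_vector_mult:
  fixes A :: "real^'n::finite^'n"
  assumes "diagonal_matrix A"
  shows "(A *v x) $ i = A $ i $ i * x $ i"
proof -
  have "(A *v x) $ i = (\<Sum>j\<in>UNIV. if j = i then A $ i $ j * x $ j else 0)"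
    unfolding matrix_vector_mult_def vec_lambda_beta
    using assms by (intro sum.cong) (auto simp: diagonal_matrix_def)
  then show ?thesis by simp
qed

text \<open>Both sides expand to the same sum of \<open>A $ i $ i * x $ i * y $ i * z $ i\<close>,
  since a diagonal matrix acts componentwise and so commutes with multiplication by
  \<open>y\<close>.\<close>

lemma inner_mult_diagonal_matrix:
  fixes A :: "real^'n::finite^'n"
  assumes "diagonal_matrix A"
  shows "(x * y) \<bullet> (A *v z) = x \<bullet> (A *v (y * z))"
  by (simp add: inner_vec_def diagonal_matrix_vector_mult[OF assms] mult_ac)

lemma inner_symmetric_matrix:
  fixes A :: "real^'n::finite^'n"
  assumes "transpose A = A"
  shows "x \<bullet> (A *v y) = y \<bullet> (A *v x)"
proof -
  have "x \<bullet> (A *v y) = (x v* transpose A) \<bullet> y"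
    by (simp only: assms dot_lmul_matrix)
  then show ?thesis by (simp add: inner_commute)
qed

context
  fixes S :: "'n::finite sbp_data"
  assumes sbp: "periodic_upwind_sbp S"
begin

lemma inner_mass_commute: "x \<bullet> (mass_matrix S *v y) = y \<bullet> (mass_matrix S *v x)"
  using sbp by (intro inner_symmetric_matrix) (simp add: periodic_upwind_sbp_def symmetric_pos_def_def)

lemma inner_mass_Dplus:
  "x \<bullet> (mass_matrix S *v (Dplus S *v y)) = - (y \<bullet> (mass_matrix S *v (Dminus S *v x)))"
proof -
  have "(mass_matrix S ** Dplus S + transpose (Dminus S) ** mass_matrix S) *v y = 0"
    using sbp by (simp add: periodic_upwind_sbp_def)
  then have "mass_matrix S *v (Dplus S *v y)
      = - (transpose (Dminus S) *v (mass_matrix S *v y))"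
    by (simp add: matrix_vector_mult_add_rdistrib eq_neg_iff_add_eq_0 flip: matrix_vector_mul_assoc)
  then have "x \<bullet> (mass_matrix S *v (Dplus S *v y))
      = - ((Dminus S *v x) \<bullet> (mass_matrix S *v y))"
    \<comment> \<open>Writing \<open>Dminus S *v x\<close> as the row product of \<open>x\<close>
      with the transpose lets \<open>dot_lmul_matrix\<close> move the operator to the other
      factor.\<close>
    by (simp add: dot_lmul_matrix flip: vector_transpose_matrix)
  then show ?thesis by (simp add: inner_mass_commute)
qed

lemma inner_mass_Dcentral:
  "x \<bullet> (mass_matrix S *v (Dcentral S *v y)) = - (y \<bullet> (mass_matrix S *v (Dcentral S *v x)))"
proof -
  have "x \<bullet> (mass_matrix S *v (Dcentral S *v y)) = (x \<bullet> (mass_matrix S *v (Dplus S *v y))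
      + x \<bullet> (mass_matrix S *v (Dminus S *v y))) / 2" for x y
    by (simp add: Dcentral_def scaleR_matrix_vector_assoc[symmetric] matrix_vector_mult_add_rdistrib
        matrix_vector_mult_scaleR matrix_vector_right_distrib inner_right_distrib)
  \<comment> \<open>Once each \<open>Dplus\<close> term is turned into a \<open>Dminus\<close> term,
    the average is visibly antisymmetric in \<open>x\<close> and \<open>y\<close>.\<close>
  from this[of x y] this[of y x] show ?thesis
    by (simp add: inner_mass_Dplus field_simps)
qed

lemma inner_mass_Dcentral_self: "x \<bullet> (mass_matrix S *v (Dcentral S *v x)) = 0"
  using inner_mass_Dcentral[of x x] by simp

lemma one_inner_mass_Dplus: "1 \<bullet> (mass_matrix S *v (Dplus S *v x)) = 0"
  using sbp by (simp add: inner_mass_Dplus periodic_upwind_sbp_def consistent_periodic_deriv_def)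

lemma one_inner_mass_Dcentral: "1 \<bullet> (mass_matrix S *v (Dcentral S *v x)) = 0"
proof -
  have "Dcentral S *v 1 = 0"
    using sbp by (simp add: periodic_upwind_sbp_def consistent_periodic_deriv_def Dcentral_def
        scaleR_matrix_vector_assoc[symmetric] matrix_vector_mult_add_rdistrib)
  then show ?thesis using inner_mass_Dcentral[of 1 x] by simp
qed

text \<open>Diagonality turns the product term into the pairing of \<open>x\<close> with its own
  central derivative, which vanishes by skewness; the other term vanishes because
  \<open>Dcentral S\<close> annihilates constants.\<close>

lemma one_inner_mass_split_flux:
  assumes "diagonal_matrix (mass_matrix S)"
  shows "1 \<bullet> (mass_matrix S *v (x * (Dcentral S *v x) + Dcentral S *v x\<^sup>2)) = 0"
  using inner_mult_diagonal_matrix[OF assms, of 1 x "Dcentral S *v x"]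
  by (simp add: matrix_vector_right_distrib inner_right_distrib one_inner_mass_Dcentral
      inner_mass_Dcentral_self)

text \<open>The product form and the conservative form contribute opposite cubic terms, which cancel
  because the splitting weights them equally.\<close>

lemma inner_mass_split_flux:
  assumes "diagonal_matrix (mass_matrix S)"
  shows "x \<bullet> (mass_matrix S *v (x * (Dcentral S *v x) + Dcentral S *v x\<^sup>2)) = 0"
  using inner_mult_diagonal_matrix[OF assms, of x x "Dcentral S *v x"]
  by (simp add: matrix_vector_right_distrib inner_right_distrib power2_eq_square
      inner_mass_Dcentral[of x "x * x"])

end

text \<open>The parameters \<delta>1, \<delta>2, \<delta>3 only distribute linear terms between the
  two summands, so the invariants can be checked on a right-hand side free of them.\<close>

lemma bbmh_rhs_sum:
  assumes "\<epsilon> \<noteq> 0"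
  shows "bbmh_rhs1 S \<epsilon> \<delta>1 \<delta>2 \<delta>3 (u, v, w) + bbmh_rhs2 S \<epsilon> \<delta>1 \<delta>2 \<delta>3 (u, v, w) =
    (- (1 / 3) *\<^sub>R (u * (Dcentral S *v u) + Dcentral S *v u\<^sup>2) - Dplus S *v v,
     (1 / \<epsilon>\<^sup>2) *\<^sub>R (w - Dminus S *v u),
     - (\<epsilon>\<^sup>2 *\<^sub>R (Dcentral S *v w)) - v)"
proof -
  \<comment> \<open>Total coefficient of \<open>Dminus S *v u\<close>, up to sign; this cancellation
    of \<delta>2 is where \<epsilon> must be nonzero.\<close>
  have "\<delta>2 / \<epsilon> + (1 - \<delta>2 * \<epsilon>) / \<epsilon>\<^sup>2 = 1 / \<epsilon>\<^sup>2"
    using assms by (simp add: field_simps power2_eq_square)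
  then have "- (\<delta>2 / \<epsilon>) *\<^sub>R x - ((1 - \<delta>2 * \<epsilon>) / \<epsilon>\<^sup>2) *\<^sub>R x = - ((1 / \<epsilon>\<^sup>2) *\<^sub>R x)" for x :: "real^'n"
    by (metis scaleR_left.add scaleR_minus_left minus_add_distrib diff_conv_add_uminus)
  from this[of "Dminus S *v u"] show ?thesis
    by (simp add: bbmh_rhs1_def bbmh_rhs2_def algebra_simps)
qed

lemma constant_on_if_vector_derivative_zero:
  fixes f :: "real \<Rightarrow> 'a::real_normed_vector"
  assumes "is_interval T"
    and "\<And>t. t \<in> T \<Longrightarrow> (f has_vector_derivative 0) (at t within T)"
  shows "f constant_on T"
proof -
  obtain c where "\<And>t. t \<in> T \<Longrightarrow> f t = c"
    using has_vector_derivative_zero_constant[OF is_interval_convex[OF assms(1)] assms(2)] by blast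
  then show ?thesis unfolding constant_on_def by blast
qed

text \<open>The product rule gives two terms, which symmetry of \<open>A\<close> makes
  equal.\<close>

lemma has_vector_derivative_inner_matrix:
  fixes A :: "real^'n::finite^'n"
  assumes "transpose A = A" and "(x has_vector_derivative x') (at t within T)"
  shows "((\<lambda>s. x s \<bullet> (A *v x s)) has_vector_derivative 2 * (x t \<bullet> (A *v x'))) (at t within T)"
proof -
  have "((\<lambda>s. A *v x s) has_vector_derivative A *v x') (at t within T)"
    by (rule bounded_linear.has_vector_derivative[OF matrix_vector_mul_bounded_linear assms(2)])
  from bounded_bilinear.has_vector_derivative[OF bounded_bilinear_inner assms(2) this]
  show ?thesis using inner_symmetric_matrix[OF assms(1), of x' "x t"] by simp
qed

theorem theorem5p4:
  fixes S :: "'n::finite sbp_data"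
    and \<epsilon> \<delta>1 \<delta>2 \<delta>3 :: real
    and T :: "real set"
    and u v w :: "real \<Rightarrow> real^'n"
  assumes "\<epsilon> > 0"
    and "\<delta>1 \<in> {0..1}" and "\<delta>2 \<in> {0..1}" and "\<delta>3 \<in> {0..1}"
    and "periodic_upwind_sbp S"
    and "diagonal_matrix (mass_matrix S)"
    and "is_interval T"
    and "bbmh_solution S \<epsilon> \<delta>1 \<delta>2 \<delta>3 T u v w"
  shows "((\<lambda>t. discrete_mass S (u t)) constant_on T) \<and>
         ((\<lambda>t. discrete_energy S \<epsilon> (u t) (v t) (w t)) constant_on T)"
proof -
  note sbp = \<open>periodic_upwind_sbp S\<close> and diag = \<open>diagonal_matrix (mass_matrix S)\<close>
  let ?M = "mass_matrix S" and ?D = "Dcentral S"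
  define u' where "u' t = - (1 / 3) *\<^sub>R (u t * (?D *v u t) + ?D *v (u t)\<^sup>2) - Dplus S *v v t" for t
  define v' where "v' t = (1 / \<epsilon>\<^sup>2) *\<^sub>R (w t - Dminus S *v u t)" for t
  define w' where "w' t = - (\<epsilon>\<^sup>2 *\<^sub>R (?D *v w t)) - v t" for t
  have deriv: "((\<lambda>s. (u s, v s, w s)) has_vector_derivative (u' t, v' t, w' t)) (at t within T)"
    if "t \<in> T" for t
    using that assms(1,8) by (simp add: bbmh_solution_def bbmh_rhs_sum u'_def v'_def w'_def)
  have u: "(u has_vector_derivative u' t) (at t within T)" if "t \<in> T" for t
    using bounded_linear.has_vector_derivative[OF bounded_linear_fst deriv[OF that]] by simp
  have vw: "((\<lambda>s. (v s, w s)) has_vector_derivative (v' t, w' t)) (at t within T)"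
    if "t \<in> T" for t
    using bounded_linear.has_vector_derivative[OF bounded_linear_snd deriv[OF that]] by simp
  have v: "(v has_vector_derivative v' t) (at t within T)" if "t \<in> T" for t
    using bounded_linear.has_vector_derivative[OF bounded_linear_fst vw[OF that]] by simp
  have w: "(w has_vector_derivative w' t) (at t within T)" if "t \<in> T" for t
    using bounded_linear.has_vector_derivative[OF bounded_linear_snd vw[OF that]] by simp
  have sym: "transpose ?M = ?M"
    using sbp by (simp add: periodic_upwind_sbp_def symmetric_pos_def_def)
  note lin = matrix_vector_mult_diff_distrib matrix_vector_mult_scaleR inner_diff_right

  have "(\<lambda>t. discrete_mass S (u t)) constant_on T"
  proof (rule constant_on_if_vector_derivative_zero[OF \<open>is_interval T\<close>])
    fix t assume t: "t \<in> T"
    have "bounded_linear (\<lambda>x. 1 \<bullet> (?M *v x))"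
      by (intro bounded_linear_compose[OF bounded_linear_inner_right]) simp
    from bounded_linear.has_vector_derivative[OF this u[OF t]]
    have "((\<lambda>s. discrete_mass S (u s)) has_vector_derivative 1 \<bullet> (?M *v u' t)) (at t within T)"
      by (simp add: discrete_mass_def)
    moreover have "1 \<bullet> (?M *v u' t) = 0"
      unfolding u'_def lin inner_scaleR_right one_inner_mass_split_flux[OF sbp diag]
      by (simp add: one_inner_mass_Dplus[OF sbp])
    ultimately show "((\<lambda>s. discrete_mass S (u s)) has_vector_derivative 0) (at t within T)"
      by simp
  qed
  moreover have "(\<lambda>t. discrete_energy S \<epsilon> (u t) (v t) (w t)) constant_on T"
  proof (rule constant_on_if_vector_derivative_zero[OF \<open>is_interval T\<close>])
    fix t assume t: "t \<in> T"
    have "u t \<bullet> (?M *v u' t) = - (u t \<bullet> (?M *v (Dplus S *v v t)))"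
      unfolding u'_def lin inner_scaleR_right inner_mass_split_flux[OF sbp diag] by simp
    \<comment> \<open>The energy weight of \<open>v\<close> cancels the stiff factor in
      \<open>v'\<close>, so that the coupling terms match those of the other two equations.\<close>
    moreover have "\<epsilon>\<^sup>2 * (v t \<bullet> (?M *v v' t))
        = v t \<bullet> (?M *v w t) - v t \<bullet> (?M *v (Dminus S *v u t))"
      using \<open>\<epsilon> > 0\<close> by (simp add: v'_def lin)
    moreover have "w t \<bullet> (?M *v w' t) = - (w t \<bullet> (?M *v v t))"
    proof -
      \<comment> \<open>Moving the sign into the scalar gives a shape that the rules
        \<open>lin\<close> can expand.\<close>
      have "w' t = (- \<epsilon>\<^sup>2) *\<^sub>R (?D *v w t) - v t" by (simp add: w'_def)
      then show ?thesis by (simp only: lin inner_scaleR_right inner_mass_Dcentral_self[OF sbp])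
    qed
    ultimately have zero: "u t \<bullet> (?M *v u' t) + \<epsilon>\<^sup>2 * (v t \<bullet> (?M *v v' t)) + w t \<bullet> (?M *v w' t) = 0"
      \<comment> \<open>Four exchange terms remain: the \<open>u\<close>-\<open>v\<close> pair
        cancels by adjointness, the \<open>v\<close>-\<open>w\<close> pair by symmetry of the mass
        matrix.\<close>
      using inner_mass_Dplus[OF sbp, of "u t" "v t"] inner_mass_commute[OF sbp, of "v t" "w t"]
      by simp
    have "((\<lambda>s. discrete_energy S \<epsilon> (u s) (v s) (w s)) has_vector_derivative
        1 / 2 * (2 * (u t \<bullet> (?M *v u' t)) + \<epsilon>\<^sup>2 * (2 * (v t \<bullet> (?M *v v' t)))
                 + 2 * (w t \<bullet> (?M *v w' t)))) (at t within T)"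
      unfolding discrete_energy_def
      by (intro has_vector_derivative_mult_right has_vector_derivative_add
          has_vector_derivative_inner_matrix[OF sym] u v w t)
    then show "((\<lambda>s. discrete_energy S \<epsilon> (u s) (v s) (w s)) has_vector_derivative 0) (at t within T)"
      using zero by (simp add: algebra_simps)
  qed
  ultimately show ?thesis ..
qed

end
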